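(* Let $A_1,\dots,A_N$ be events in a probability space such that the $N\times N$ matrix $\boldsymbol{\Sigma}=(P(A_i\cap A_j))_{i,j=1}^N$ is non-singular. Then the Gallot--Kounias (GK) bound cannot be improved via optimization over subsets of $\{A_1,\dots,A_N\}$; that is, for every nonempty subset $\mathcal{I}\subseteq\{1,\dots,N\}$, the GK bound computed from the events $\{A_i\}_{i\in\mathcal{I}}$ satisfies $$\boldsymbol{\alpha}_{\mathcal{I}}^T\boldsymbol{\Sigma}_{\mathcal{I}}^{-1}\boldsymbol{\alpha}_{\mathcal{I}}\le \boldsymbol{\alpha}^T\boldsymbol{\Sigma}^{-1}\boldsymbol{\alpha},$$ where $\boldsymbol{\alpha}=(P(A_1),\dots,P(A_N))^T$, $\boldsymbol{\alpha}_{\mathcal{I}}=(P(A_i))_{i\in\mathcal{I}}$ and $\boldsymbol{\Sigma}_{\mathcal{I}}=(P(A_i\cap A_j))_{i,j\in\mathcal{I}}$.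
   Context: For events $A_1,\dots,A_N$ with $\boldsymbol{\alpha}=(P(A_1),\dots,P(A_N))^T\in\mathbb{R}^{N}$ and $\boldsymbol{\Sigma}=(P(A_i\cap A_j))_{i,j=1}^N\in\mathbb{R}^{N\times N}$ (so the diagonal entries are $P(A_i)$), with $\boldsymbol{\Sigma}$ non-singular, the Gallot--Kounias (GK) bound is the lower bound $P\left(\bigcup_{i=1}^N A_i\right)\ge \ell_{\mathrm{GK}}:=\boldsymbol{\alpha}^T\boldsymbol{\Sigma}^{-1}\boldsymbol{\alpha}$. The GK bound for a subset of the events is the same expression formed from the events in the subset. Since $\boldsymbol{\Sigma}$ is a Gram matrix (of the indicator functions of the events) and is non-singular, it is positive definite, so each principal submatrix $\boldsymbol{\Sigma}_{\mathcal{I}}$ is also invertible. *)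

theory Defs
  imports "HOL-Probability.Probability_Measure" "Jordan_Normal_Form.Gauss_Jordan_Elimination"
begin

text \<open>The events are a family \<open>A\<close> indexed by natural numbers, of which only the members with index
  in the finite set \<open>I\<close> matter. Coordinates of \<open>Matrix.vec\<close> and \<open>mat\<close> are numbered from 0, so the
  coordinate \<open>k\<close> belongs to the \<open>k\<close>-th smallest element of \<open>I\<close>.\<close>

definition event_probs :: "'a measure \<Rightarrow> (nat \<Rightarrow> 'a set) \<Rightarrow> nat set \<Rightarrow> real Matrix.vec" where
  "event_probs M A I =
     Matrix.vec (card I) (\<lambda>k. measure M (A (sorted_list_of_set I ! k)))"

definition intersection_probs :: "'a measure \<Rightarrow> (nat \<Rightarrow> 'a set) \<Rightarrow> nat set \<Rightarrow> real mat" where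
  "intersection_probs M A I =
     mat (card I) (card I)
       (\<lambda>(k, l). measure M (A (sorted_list_of_set I ! k) \<inter> A (sorted_list_of_set I ! l)))"

text \<open>\<open>mat_inverse\<close> yields \<open>None\<close> on singular matrices; the bound is meaningful only when
  \<open>intersection_probs M A I\<close> is non-singular.\<close>

definition gk_bound :: "'a measure \<Rightarrow> (nat \<Rightarrow> 'a set) \<Rightarrow> nat set \<Rightarrow> real" where
  "gk_bound M A I =
     scalar_prod (event_probs M A I)
       (the (mat_inverse (intersection_probs M A I)) *\<^sub>v event_probs M A I)"

end

theory Submission
  imports Defs "Jordan_Normal_Form.Determinant"
begin

text \<open>
  In \<open>L\<^sup>2(M)\<close> the matrix \<open>\<Sigma>\<close> is the Gram matrix of the indicators of the events, and
  \<open>\<alpha>\<close> holds their inner products with the constant function 1. Hence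
  \<open>c = \<Sigma>\<inverse> \<alpha>\<close> consists of the coefficients of the orthogonal projection of 1 onto the span of the
  indicators, and the bound \<open>\<alpha> \<bullet> c\<close> is the squared norm of this projection. Fewer events span a
  smaller subspace, and projecting onto a smaller subspace cannot give a longer vector.

  In coordinates, let \<open>d\<close> solve the normal equations \<open>\<Sigma> d = \<alpha>\<close> of the larger family, and let \<open>e\<close>
  be the solution for the smaller family, extended by zero. The normal equations turn each of the
  numbers \<open>d \<bullet> \<Sigma> d\<close>, \<open>d \<bullet> \<Sigma> e\<close> and \<open>e \<bullet> \<Sigma> e\<close> into one of the two bounds, and the gap
  between the bounds becomes \<open>(d - e) \<bullet> \<Sigma> (d - e) \<ge> 0\<close>; this is \<open>gk_bound_mono\<close>.

  That the smaller family has normal equations to solve is part of the claim, because the inverse of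
  its matrix is specified only if it exists. Non-singularity passes to subfamilies because a Gram form
  vanishes only at combinations of indicators that are zero almost everywhere
  (\<open>gram_form_eq_0_imp_orthogonal\<close>, \<open>independent_indicators_subset\<close>).
\<close>

section \<open>Linear combinations of indicators\<close>

definition indicator_combination :: "('i \<Rightarrow> 'a set) \<Rightarrow> 'i set \<Rightarrow> ('i \<Rightarrow> real) \<Rightarrow> 'a \<Rightarrow> real" where
  "indicator_combination A I c x = (\<Sum>i\<in>I. c i * indicator (A i) x)"

context finite_measure
begin

lemma has_integral_indicator_combination:
  assumes "\<And>i. i \<in> I \<Longrightarrow> A i \<in> sets M" and "B \<in> sets M"
  shows "has_bochner_integral M (\<lambda>x. indicator_combination A I c x * indicator B x)
           (\<Sum>i\<in>I. measure M (A i \<inter> B) * c i)"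
proof -
  have "has_bochner_integral M (\<lambda>x. \<Sum>i\<in>I. indicator (A i \<inter> B) x * c i)
          (\<Sum>i\<in>I. measure M (A i \<inter> B) * c i)"
    using assms
    by (intro has_bochner_integral_sum has_bochner_integral_mult_left
        has_bochner_integral_real_indicator) (auto simp: emeasure_eq_measure)
  moreover have "indicator_combination A I c x * indicator B x
      = (\<Sum>i\<in>I. indicator (A i \<inter> B) x * c i)" for x
    unfolding indicator_combination_def sum_distrib_right
    by (intro sum.cong) (simp_all add: indicator_inter_arith)
  ultimately show ?thesis by simp
qed

text \<open>The identity that makes the matrix of intersection probabilities a Gram matrix: its quadratic
  form is a squared \<open>L\<^sup>2\<close> norm.\<close>

lemma has_integral_indicator_combination_square:
  fixes c :: "'i \<Rightarrow> real"
  assumes "\<And>i. i \<in> I \<Longrightarrow> A i \<in> sets M"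
  shows "has_bochner_integral M (\<lambda>x. (indicator_combination A I c x)\<^sup>2)
           (\<Sum>j\<in>I. (\<Sum>i\<in>I. measure M (A i \<inter> A j) * c i) * c j)"
proof -
  have "has_bochner_integral M
          (\<lambda>x. \<Sum>j\<in>I. indicator_combination A I c x * indicator (A j) x * c j)
          (\<Sum>j\<in>I. (\<Sum>i\<in>I. measure M (A i \<inter> A j) * c i) * c j)"
    using assms
    by (intro has_bochner_integral_sum has_bochner_integral_mult_left
        has_integral_indicator_combination) auto
  moreover have "(indicator_combination A I c x)\<^sup>2
      = (\<Sum>j\<in>I. indicator_combination A I c x * indicator (A j) x * c j)" for x
  proof -
    have "(indicator_combination A I c x)\<^sup>2
        = indicator_combination A I c x * (\<Sum>j\<in>I. c j * indicator (A j) x)"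
      by (simp add: power2_eq_square indicator_combination_def)
    then show ?thesis
      unfolding sum_distrib_left by (simp only: mult.assoc mult.commute[of "c _"])
  qed
  ultimately show ?thesis by simp
qed

lemma gram_form_nonneg:
  fixes c :: "'i \<Rightarrow> real"
  assumes "\<And>i. i \<in> I \<Longrightarrow> A i \<in> sets M"
  shows "0 \<le> (\<Sum>j\<in>I. (\<Sum>i\<in>I. measure M (A i \<inter> A j) * c i) * c j)"
proof -
  have "0 \<le> (\<integral>x. (indicator_combination A I c x)\<^sup>2 \<partial>M)"
    by simp
  also have "\<dots> = (\<Sum>j\<in>I. (\<Sum>i\<in>I. measure M (A i \<inter> A j) * c i) * c j)"
    using assms
    by (intro has_bochner_integral_integral_eq has_integral_indicator_combination_square)
  finally show ?thesis .
qed

text \<open>If the squared norm of a combination vanishes, the combination is zero almost everywhere, so its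
  inner product with the indicator of every event vanishes, in particular with events outside
  the family. This is what allows passing from a subfamily to the whole family.\<close>

lemma gram_form_eq_0_imp_orthogonal:
  fixes c :: "'i \<Rightarrow> real"
  assumes A: "\<And>i. i \<in> I \<Longrightarrow> A i \<in> sets M" and B: "B \<in> sets M"
    and 0: "(\<Sum>j\<in>I. (\<Sum>i\<in>I. measure M (A i \<inter> A j) * c i) * c j) = 0"
  shows "(\<Sum>i\<in>I. measure M (A i \<inter> B) * c i) = 0"
proof -
  have square: "has_bochner_integral M (\<lambda>x. (indicator_combination A I c x)\<^sup>2) 0"
    unfolding 0[symmetric] using A by (rule has_integral_indicator_combination_square)
  have "AE x in M. (indicator_combination A I c x)\<^sup>2 = 0"
    using square
    by (subst integral_nonneg_eq_0_iff_AE[symmetric])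
       (auto simp: has_bochner_integral_iff)
  then have "AE x in M. indicator_combination A I c x * indicator B x = 0"
    by eventually_elim simp
  then have "(\<integral>x. indicator_combination A I c x * indicator B x \<partial>M) = 0"
    by (rule integral_eq_zero_AE)
  moreover have "(\<integral>x. indicator_combination A I c x * indicator B x \<partial>M)
      = (\<Sum>i\<in>I. measure M (A i \<inter> B) * c i)"
    using A B by (intro has_bochner_integral_integral_eq has_integral_indicator_combination)
  ultimately show ?thesis by simp
qed

end

section \<open>From coordinates to index sets\<close>

text \<open>Extending coefficients by zero and comparing sums over nested index sets is awkward with
  vectors whose coordinates are ranks in \<open>I\<close>. Coefficients are therefore functions on the
  indices themselves, and this encoding translates every matrix operation into sums over \<open>I\<close>.\<close>

definition coefficient_vec :: "nat set \<Rightarrow> (nat \<Rightarrow> real) \<Rightarrow> real Matrix.vec" where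
  "coefficient_vec I c = Matrix.vec (card I) (\<lambda>k. c (sorted_list_of_set I ! k))"

lemma coefficient_vec_carrier [simp]: "coefficient_vec I c \<in> carrier_vec (card I)"
  by (simp add: coefficient_vec_def)

lemma intersection_probs_carrier [simp]:
  "intersection_probs M A I \<in> carrier_mat (card I) (card I)"
  by (simp add: intersection_probs_def)

lemma event_probs_eq_coefficient_vec:
  "event_probs M A I = coefficient_vec I (\<lambda>i. measure M (A i))"
  by (simp add: event_probs_def coefficient_vec_def)

lemma bij_betw_sorted_list_of_set_nth:
  assumes "finite I"
  shows "bij_betw ((!) (sorted_list_of_set I)) {0..<card I} I"
  using assms by (intro bij_betw_nth) auto

lemma sum_sorted_list_of_set_nth:
  assumes "finite I"
  shows "(\<Sum>k = 0..<card I. f (sorted_list_of_set I ! k)) = sum f I"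
  using sum.reindex_bij_betw[OF bij_betw_sorted_list_of_set_nth[OF assms]] .

lemma coefficient_vec_eq_iff:
  assumes "finite I"
  shows "coefficient_vec I c = coefficient_vec I d \<longleftrightarrow> (\<forall>i\<in>I. c i = d i)"
proof -
  have "(\<forall>i\<in>(!) (sorted_list_of_set I) ` {0..<card I}. c i = d i)
      \<longleftrightarrow> (\<forall>k\<in>{0..<card I}. c (sorted_list_of_set I ! k) = d (sorted_list_of_set I ! k))"
    by blast
  then show ?thesis
    unfolding bij_betw_imp_surj_on[OF bij_betw_sorted_list_of_set_nth[OF assms]]
    by (auto simp: coefficient_vec_def vec_eq_iff)
qed

lemma coefficient_vec_zero: "coefficient_vec I (\<lambda>i. 0) = 0\<^sub>v (card I)"
  by (auto simp: coefficient_vec_def)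

lemma coefficient_vec_exhaust:
  assumes "finite I" and "v \<in> carrier_vec (card I)"
  obtains c where "v = coefficient_vec I c"
proof -
  let ?f = "the_inv_into {0..<card I} ((!) (sorted_list_of_set I))"
  have "v = coefficient_vec I (\<lambda>i. vec_index v (?f i))"
    using assms bij_betw_imp_inj_on[OF bij_betw_sorted_list_of_set_nth[OF assms(1)]]
    by (intro eq_vecI) (auto simp: coefficient_vec_def the_inv_into_f_f)
  then show ?thesis by (rule that)
qed

lemma scalar_prod_coefficient_vec:
  assumes "finite I"
  shows "coefficient_vec I c \<bullet> coefficient_vec I d = (\<Sum>i\<in>I. c i * d i)"
  using sum_sorted_list_of_set_nth[OF assms, of "\<lambda>i. c i * d i"]
  by (simp add: coefficient_vec_def scalar_prod_def)

lemma intersection_probs_mult_coefficient_vec: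
  assumes "finite I"
  shows "intersection_probs M A I *\<^sub>v coefficient_vec I c
           = coefficient_vec I (\<lambda>j. \<Sum>i\<in>I. measure M (A i \<inter> A j) * c i)"
proof (intro eq_vecI)
  let ?s = "sorted_list_of_set I"
  fix k assume "k < dim_vec (coefficient_vec I (\<lambda>j. \<Sum>i\<in>I. measure M (A i \<inter> A j) * c i))"
  then have k: "k < card I" by (simp add: coefficient_vec_def)
  then have "vec_index (intersection_probs M A I *\<^sub>v coefficient_vec I c) k
      = (\<Sum>l = 0..<card I. measure M (A (?s ! k) \<inter> A (?s ! l)) * c (?s ! l))"
    by (simp add: coefficient_vec_def intersection_probs_def scalar_prod_def)
  also have "\<dots> = (\<Sum>i\<in>I. measure M (A (?s ! k) \<inter> A i) * c i)"
    by (rule sum_sorted_list_of_set_nth[OF assms])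
  finally show "vec_index (intersection_probs M A I *\<^sub>v coefficient_vec I c) k
      = vec_index (coefficient_vec I (\<lambda>j. \<Sum>i\<in>I. measure M (A i \<inter> A j) * c i)) k"
    using k by (simp add: coefficient_vec_def Int_commute)
qed (simp add: coefficient_vec_def intersection_probs_def)

section \<open>Normal equations\<close>

text \<open>Triviality of the kernel of the matrix of intersection probabilities, without reference to
  coordinates; equivalently, linear independence of the indicators in \<open>L\<^sup>2(M)\<close>.\<close>

definition independent_indicators :: "'a measure \<Rightarrow> (nat \<Rightarrow> 'a set) \<Rightarrow> nat set \<Rightarrow> bool" where
  "independent_indicators M A I \<longleftrightarrow>
     (\<forall>c. (\<forall>j\<in>I. (\<Sum>i\<in>I. measure M (A i \<inter> A j) * c i) = 0) \<longrightarrow> (\<forall>i\<in>I. c i = 0))"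

lemma independent_indicatorsD:
  assumes "independent_indicators M A I"
    and "\<And>j. j \<in> I \<Longrightarrow> (\<Sum>i\<in>I. measure M (A i \<inter> A j) * c i) = 0"
    and "i \<in> I"
  shows "c i = 0"
  using assms unfolding independent_indicators_def by blast

lemma invertible_imp_independent_indicators:
  assumes fin: "finite I" and inv: "invertible_mat (intersection_probs M A I)"
  shows "independent_indicators M A I"
  unfolding independent_indicators_def
proof (intro allI impI)
  let ?S = "intersection_probs M A I" and ?n = "card I"
  fix c assume c: "\<forall>j\<in>I. (\<Sum>i\<in>I. measure M (A i \<inter> A j) * c i) = 0"
  obtain T where T: "?S * T = 1\<^sub>m (dim_row ?S)" "T * ?S = 1\<^sub>m (dim_row T)"
    using inv unfolding invertible_mat_def inverts_mat_def by blast
  have dims: "dim_row ?S = ?n" "dim_col ?S = ?n"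
    by (simp_all add: intersection_probs_def)
  have "dim_row T = ?n"
    using arg_cong[OF T(2), of dim_col] dims by simp
  moreover have "dim_col T = ?n"
    using arg_cong[OF T(1), of dim_col] dims by simp
  ultimately have T_carrier: "T \<in> carrier_mat ?n ?n" by blast
  have "?S *\<^sub>v coefficient_vec I c = coefficient_vec I (\<lambda>i. 0)"
    using c by (simp add: intersection_probs_mult_coefficient_vec coefficient_vec_eq_iff fin)
  then have "T *\<^sub>v (?S *\<^sub>v coefficient_vec I c) = T *\<^sub>v 0\<^sub>v ?n"
    by (simp add: coefficient_vec_zero)
  moreover have "T *\<^sub>v 0\<^sub>v ?n = 0\<^sub>v ?n"
    using T_carrier by (intro eq_vecI) auto
  moreover have "T *\<^sub>v (?S *\<^sub>v coefficient_vec I c) = coefficient_vec I c"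
    using T(2) T_carrier
    by (simp flip: assoc_mult_mat_vec[OF T_carrier intersection_probs_carrier])
  ultimately show "\<forall>i\<in>I. c i = 0"
    using coefficient_vec_eq_iff[OF fin, of c "\<lambda>i. 0"] by (simp add: coefficient_vec_zero)
qed

text \<open>A kernel vector of the smaller matrix, extended by zero, satisfies the equations of the larger
  matrix that belong to \<open>I\<close>. It satisfies the remaining ones too, since its Gram form
  vanishes and so it is orthogonal to every event.\<close>

lemma independent_indicators_subset:
  assumes "finite_measure M" and fin: "finite J" and sub: "I \<subseteq> J"
    and meas: "\<And>i. i \<in> J \<Longrightarrow> A i \<in> sets M"
    and indep: "independent_indicators M A J"
  shows "independent_indicators M A I"
  unfolding independent_indicators_def
proof (intro allI impI)
  interpret finite_measure M by fact
  fix c assume c: "\<forall>j\<in>I. (\<Sum>i\<in>I. measure M (A i \<inter> A j) * c i) = 0"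
  let ?d = "\<lambda>i. if i \<in> I then c i else 0"
  have "(\<Sum>i\<in>J. measure M (A i \<inter> A j) * ?d i) = 0" if "j \<in> J" for j
  proof -
    have "(\<Sum>i\<in>J. measure M (A i \<inter> A j) * ?d i) = (\<Sum>i\<in>I. measure M (A i \<inter> A j) * c i)"
      using fin sub by (intro sum.mono_neutral_cong_right) auto
    also have "\<dots> = 0"
      using that sub c
      by (intro gram_form_eq_0_imp_orthogonal) (auto intro: meas)
    finally show ?thesis .
  qed
  then have "?d i = 0" if "i \<in> J" for i
    using that by (rule independent_indicatorsD[where c = ?d, OF indep])
  then show "\<forall>i\<in>I. c i = 0"
    using sub by (metis subset_iff)
qed

text \<open>The solution of the normal equations, not the inverse matrix, is what gets compared between
  families: the coefficients \<open>c\<close> are those of the projection of 1 onto the span of the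
  indicators.\<close>

lemma gk_bound_normal_equations:
  assumes fin: "finite I" and indep: "independent_indicators M A I"
  obtains c where "\<And>j. j \<in> I \<Longrightarrow> (\<Sum>i\<in>I. measure M (A i \<inter> A j) * c i) = measure M (A j)"
    and "gk_bound M A I = (\<Sum>i\<in>I. measure M (A i) * c i)"
proof -
  let ?S = "intersection_probs M A I" and ?n = "card I"
  let ?R = "ring_mat TYPE(real) ?n ()"
  have "Determinant.det ?S \<noteq> 0"
  proof
    assume "Determinant.det ?S = 0"
    then obtain v where v: "v \<in> carrier_vec ?n" "v \<noteq> 0\<^sub>v ?n" "?S *\<^sub>v v = 0\<^sub>v ?n"
      using det_0_iff_vec_prod_zero_field[OF intersection_probs_carrier] by blast
    obtain c where c: "v = coefficient_vec I c"
      using coefficient_vec_exhaust[OF fin v(1)] .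
    from v(3) have "\<forall>j\<in>I. (\<Sum>i\<in>I. measure M (A i \<inter> A j) * c i) = 0"
      by (simp add: c intersection_probs_mult_coefficient_vec coefficient_vec_eq_iff fin
          flip: coefficient_vec_zero)
    then have "\<forall>i\<in>I. c i = 0"
      by (blast intro: independent_indicatorsD[OF indep])
    then show False
      using v(2) by (simp add: c coefficient_vec_eq_iff fin flip: coefficient_vec_zero)
  qed
  then have "?S \<in> Units ?R"
    by (rule det_non_zero_imp_unit[OF intersection_probs_carrier])
  then obtain T where some: "mat_inverse ?S = Some T"
    using mat_inverse(1)[OF intersection_probs_carrier] by (metis not_Some_eq)
  then have T: "?S * T = 1\<^sub>m ?n" "T \<in> carrier_mat ?n ?n"
    using mat_inverse(2)[OF intersection_probs_carrier] by blast+
  have "T *\<^sub>v event_probs M A I \<in> carrier_vec ?n"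
    using T(2) by (auto simp: event_probs_eq_coefficient_vec)
  then obtain c where c: "T *\<^sub>v event_probs M A I = coefficient_vec I c"
    using coefficient_vec_exhaust[OF fin] by blast
  have "?S *\<^sub>v coefficient_vec I c = event_probs M A I"
    by (simp add: T event_probs_eq_coefficient_vec flip: c
        assoc_mult_mat_vec[OF intersection_probs_carrier T(2)])
  then have "(\<Sum>i\<in>I. measure M (A i \<inter> A j) * c i) = measure M (A j)" if "j \<in> I" for j
    using that
    by (simp add: event_probs_eq_coefficient_vec intersection_probs_mult_coefficient_vec
        coefficient_vec_eq_iff fin)
  moreover have "gk_bound M A I = (\<Sum>i\<in>I. measure M (A i) * c i)"
    unfolding gk_bound_def some option.sel c
    by (simp add: event_probs_eq_coefficient_vec scalar_prod_coefficient_vec fin)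
  ultimately show ?thesis by (rule that)
qed

section \<open>Monotonicity of the bound\<close>

text \<open>With \<open>b\<close> the bilinear Gram form on \<open>J\<close>, the equations for \<open>J\<close> evaluate \<open>b d d\<close> and
  \<open>b d e\<close>, and those for \<open>I\<close> evaluate \<open>b e e\<close>, as \<open>e\<close> is supported in \<open>I\<close>. Thus
  \<open>b (d - e) (d - e)\<close> is exactly the gap between the bounds.\<close>

lemma gk_bound_mono:
  assumes "finite_measure M" and fin: "finite J" and sub: "I \<subseteq> J"
    and meas: "\<And>i. i \<in> J \<Longrightarrow> A i \<in> sets M"
    and indep: "independent_indicators M A J"
  shows "gk_bound M A I \<le> gk_bound M A J"
proof -
  interpret finite_measure M by fact
  have finI: "finite I" using sub fin by (rule finite_subset)
  obtain d where d: "\<And>j. j \<in> J \<Longrightarrow> (\<Sum>i\<in>J. measure M (A i \<inter> A j) * d i) = measure M (A j)"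
    and gkJ: "gk_bound M A J = (\<Sum>j\<in>J. measure M (A j) * d j)"
    using gk_bound_normal_equations[OF fin indep] by blast
  obtain c where c: "\<And>j. j \<in> I \<Longrightarrow> (\<Sum>i\<in>I. measure M (A i \<inter> A j) * c i) = measure M (A j)"
    and gkI: "gk_bound M A I = (\<Sum>j\<in>I. measure M (A j) * c j)"
    using gk_bound_normal_equations[OF finI
        independent_indicators_subset[OF assms(1) fin sub meas indep]] by blast
  define e where "e i = (if i \<in> I then c i else 0)" for i
  define b where "b u v = (\<Sum>j\<in>J. (\<Sum>i\<in>J. measure M (A i \<inter> A j) * u i) * v j)"
    for u v :: "nat \<Rightarrow> real"
  have restrict: "(\<Sum>i\<in>J. f i * e i) = (\<Sum>i\<in>I. f i * c i)" for f
    unfolding e_def using fin sub by (intro sum.mono_neutral_cong_right) auto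
  have dd: "b d d = gk_bound M A J"
    by (simp add: b_def d gkJ)
  have de: "b d e = gk_bound M A I"
    by (simp add: b_def d gkI restrict)
  have ee: "b e e = gk_bound M A I"
    by (simp add: b_def c gkI restrict)
  have b_commute: "b e d = b d e"
    unfolding b_def sum_distrib_right
    by (subst sum.swap) (simp add: Int_commute ac_simps)
  have "0 \<le> b (\<lambda>i. d i - e i) (\<lambda>i. d i - e i)"
    unfolding b_def using meas by (rule gram_form_nonneg)
  also have "\<dots> = b d d - b d e - b e d + b e e"
    by (simp add: b_def algebra_simps sum_subtractf sum.distrib)
  finally show ?thesis by (simp add: dd de ee b_commute)
qed

theorem theorem3p2:
  fixes M :: "'a measure" and A :: "nat \<Rightarrow> 'a set" and N :: nat and I :: "nat set"
  assumes "prob_space M"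
    and "\<And>i. i \<in> {1..N} \<Longrightarrow> A i \<in> sets M"
    and "invertible_mat (intersection_probs M A {1..N})"
    and "I \<subseteq> {1..N}" and "I \<noteq> {}"
  shows "gk_bound M A I \<le> gk_bound M A {1..N}"
proof (rule gk_bound_mono)
  show "finite_measure M"
    using assms(1) by (rule prob_space.finite_measure)
  show "A i \<in> sets M" if "i \<in> {1..N}" for i
    using that by (rule assms(2))
  show "independent_indicators M A {1..N}"
    using assms(3) by (intro invertible_imp_independent_indicators) simp
qed (rule finite_atLeastAtMost, rule assms(4))

end
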